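(* Let $\mu$ be a probability measure on $\mathbb{R}^d$ that is absolutely continuous with respect to Lebesgue measure, let $t>0$, and let $\eta$ be a Poisson point process on $\mathbb{R}^d$ with intensity measure $t\mu$. Let $\Pi_t$ be the convex hull of the points of $\eta$, and let $I(\Pi_t)$ be the number of points of $\eta$ lying in the interior of $\Pi_t$. Then the generating function $g_{I(\Pi_t)}(z)=\mathbb{E}\, z^{I(\Pi_t)}$ and the moment generating function $h_{\mu(\Pi_t)}(z)=\mathbb{E}\, e^{z\mu(\Pi_t)}$ are entire functions on $\mathbb{C}$ and satisfy, for all $z\in\mathbb{C}$, $$g_{I(\Pi_t)}(z+1)=h_{\mu(\Pi_t)}(tz).$$
   Context: A Poisson point process $\eta$ with intensity measure $t\mu$ is a random finite simple counting measure such that $\eta(A)$ is Poisson distributed with parameter $t\mu(A)$ for every Borel set $A$ and $\eta(A_1),\dots,\eta(A_m)$ are independent for pairwise disjoint Borel sets. $\mu(\Pi_t)$ denotes the $\mu$-measure of the random polytope $\Pi_t$. *)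

theory Defs
  imports "HOL-Probability.Probability"
begin

text \<open>A Poisson point process on a Euclidean space with intensity measure \<open>\<nu>\<close>
  (assumed locally finite / finite), defined on the probability space \<open>M\<close>:
  a random finite simple counting measure, represented by its (finite) support
  \<open>\<eta> \<omega>\<close>, such that the counts \<open>\<eta>(A) = card (\<eta> \<omega> \<inter> A)\<close> are random variables,
  Poisson distributed with parameter \<open>\<nu>(A)\<close>, and independent for pairwise
  disjoint Borel sets.\<close>

definition poisson_point_process ::
  "'b measure \<Rightarrow> 'a::euclidean_space measure \<Rightarrow> ('b \<Rightarrow> 'a set) \<Rightarrow> bool" where
  "poisson_point_process M \<nu> \<eta> \<longleftrightarrow>
     prob_space M \<and>
     (\<forall>\<omega>\<in>space M. finite (\<eta> \<omega>)) \<and>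
     (\<forall>A\<in>sets borel.
        (\<lambda>\<omega>. card (\<eta> \<omega> \<inter> A)) \<in> measurable M (count_space UNIV) \<and>
        (\<forall>k::nat. measure M {\<omega>\<in>space M. card (\<eta> \<omega> \<inter> A) = k}
                   = measure \<nu> A ^ k / fact k * exp (- measure \<nu> A))) \<and>
     (\<forall>(I::nat set) A. finite I \<longrightarrow> (\<forall>i\<in>I. A i \<in> sets borel) \<longrightarrow> disjoint_family_on A I \<longrightarrow>
        prob_space.indep_vars M (\<lambda>_. count_space UNIV) (\<lambda>i \<omega>. card (\<eta> \<omega> \<inter> A i)) I)"

end

theory Submission
  imports Defs "HOL-Complex_Analysis.Complex_Analysis"
begin

text \<open>
  The process is discretised by Borel maps \<open>c\<close> of finite range that converge to the identity.
  A cell is inner if the closed ball of radius \<open>\<epsilon>\<close> around its representative lies in the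
  convex hull of the occupied representatives. Removing the inner cells does not change this hull,
  so given the set \<open>K\<close> of occupied cells that are not inner, the inner cells are determined, and
  their counts are still independent Poisson variables. Summation over \<open>K\<close> yields the identity
  exactly for the discretised process.

  If \<open>\<epsilon>\<close> is three times the error of \<open>c\<close>, then for every realisation of the process a point is
  eventually in an inner cell if and only if it is in the interior of the hull. The frontier of the hull is
  null by absolute continuity, so the identity passes to the limit by dominated convergence. The measurability
  of \<open>I\<close> and \<open>V\<close> comes out of the same approximation. The generating function is entire as an
  everywhere convergent power series, and the moment generating function inherits this from the identity.
\<close>

section \<open>Convex hulls under small perturbations\<close>

text \<open>A point outside \<open>C\<close> could be separated strictly from \<open>C\<close> by a
  hyperplane. Moving it by \<open>m\<close> along the normal, away from \<open>C\<close>, keeps it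
  in the ball of radius \<open>r\<close> but leaves no point of \<open>C\<close> within distance
  \<open>m\<close>.\<close>

lemma cball_subset_of_neighbourhood:
  fixes C :: "'a::euclidean_space set"
  assumes C: "closed C" "convex C"
    and near: "\<And>y. y \<in> cball x r \<Longrightarrow> \<exists>c\<in>C. dist y c \<le> m"
    and m: "0 \<le> m"
  shows "cball x (r - m) \<subseteq> C"
proof
  fix y assume y: "y \<in> cball x (r - m)"
  show "y \<in> C"
  proof (rule ccontr)
    assume "y \<notin> C"
    then obtain a b where ab: "a \<bullet> y < b" "\<And>c. c \<in> C \<Longrightarrow> b < a \<bullet> c"
      using separating_hyperplane_closed_point[OF C(2,1)] by blast
    \<comment> \<open>\<open>sgn a\<close> is the unit normal pointing towards \<open>C\<close>, or
      0 in the degenerate case \<open>a = 0\<close>.\<close>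
    define y' where "y' = y - m *\<^sub>R sgn a"
    have "dist y y' \<le> m"
      using m by (auto simp: y'_def dist_norm norm_sgn)
    then have "y' \<in> cball x r"
      using y dist_triangle[of x y' y] by auto
    then obtain c where c: "c \<in> C" "dist y' c \<le> m"
      using near by blast
    have "a \<bullet> (c - y') \<le> norm a * m"
      using c(2) norm_cauchy_schwarz[of a "c - y'"]
      by (smt (verit) dist_commute dist_norm mult_left_mono norm_ge_zero)
    moreover have "a \<bullet> y' = a \<bullet> y - norm a * m"
      by (cases "a = 0")
        (simp_all add: y'_def inner_diff_right sgn_div_norm dot_square_norm power2_eq_square)
    ultimately have "a \<bullet> c \<le> a \<bullet> y"
      by (simp add: inner_diff_right)
    with ab c(1) show False by fastforce
  qed
qed

text \<open>The Minkowski sum \<open>?D\<close> of \<open>convex hull B\<close> and the ball of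
  radius \<open>m\<close> is convex and contains \<open>A\<close>, so it contains the hull of
  \<open>A\<close>.\<close>

lemma convex_hull_near:
  fixes A B :: "'a::real_normed_vector set"
  assumes near: "\<And>a. a \<in> A \<Longrightarrow> \<exists>b\<in>B. dist a b \<le> m"
    and y: "y \<in> convex hull A"
  shows "\<exists>c\<in>convex hull B. dist y c \<le> m"
proof -
  let ?D = "\<Union>x\<in>convex hull B. \<Union>e\<in>cball 0 m. {x + e}"
  have "A \<subseteq> ?D"
  proof
    fix a assume "a \<in> A"
    then obtain b where b: "b \<in> B" "dist a b \<le> m"
      using near by blast
    have "a = b + (a - b)" "a - b \<in> cball 0 m"
      using b(2) by (auto simp: dist_norm norm_minus_commute)
    then show "a \<in> ?D"
      using hull_inc[OF b(1), of convex] by blast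
  qed
  then have "convex hull A \<subseteq> ?D"
    by (rule hull_minimal) (intro convex_sums convex_convex_hull convex_cball)
  with y obtain c e where "c \<in> convex hull B" "e \<in> cball 0 m" "y = c + e"
    by blast
  then show ?thesis
    by (auto simp: dist_norm intro!: bexI[of _ c])
qed

text \<open>Moving the points by at most \<open>m\<close> costs a ball inside the hull at most
  \<open>m\<close> of its radius. This is applied both from a point set to its discretisation and
  back.\<close>

lemma cball_subset_convex_hull_near:
  fixes A B :: "'a::euclidean_space set"
  assumes "finite B" "\<And>a. a \<in> A \<Longrightarrow> \<exists>b\<in>B. dist a b \<le> m" "0 \<le> m"
    and "cball x r \<subseteq> convex hull A"
  shows "cball x (r - m) \<subseteq> convex hull B"
proof (rule cball_subset_of_neighbourhood)
  show "closed (convex hull B)"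
    using assms(1) by (simp add: finite_imp_compact_convex_hull compact_imp_closed)
  show "\<exists>c\<in>convex hull B. dist y c \<le> m" if "y \<in> cball x r" for y
    using convex_hull_near[OF assms(2)] assms(4) that by blast
qed (use assms in auto)

text \<open>The factor 3: one \<open>m n\<close> is lost between the two hulls, one in moving the
  centre from \<open>c n x\<close> to \<open>x\<close>, and the last leaves a ball of positive
  radius around \<open>x\<close>.\<close>

lemma eventually_cball_subset_discretised_hull_iff:
  fixes c :: "nat \<Rightarrow> 'a::euclidean_space \<Rightarrow> 'a"
  assumes fin: "finite S"
    and m: "m \<longlonglongrightarrow> 0" "\<And>n. 0 < m n"
    and c: "\<And>x. \<forall>\<^sub>F n in sequentially. dist (c n x) x \<le> m n"
  shows "\<forall>\<^sub>F n in sequentially.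
    cball (c n x) (3 * m n) \<subseteq> convex hull (c n ` S) \<longleftrightarrow> x \<in> interior (convex hull S)"
proof -
  have evS: "\<forall>\<^sub>F n in sequentially. \<forall>s\<in>S. dist (c n s) s \<le> m n"
    using fin c by (simp add: eventually_ball_finite)
  obtain d where d: "0 < d" "x \<in> interior (convex hull S) \<Longrightarrow> cball x d \<subseteq> convex hull S"
  proof (cases "x \<in> interior (convex hull S)")
    case True
    then show ?thesis using that by (auto simp: mem_interior_cball)
  qed (use that[of 1] in auto)
  \<comment> \<open>The ball of radius \<open>d\<close> around \<open>x\<close> shrinks to radius
    \<open>d - m n\<close> and must still contain the ball of radius \<open>3 * m n\<close> around
    \<open>c n x\<close>, which is within \<open>m n\<close> of \<open>x\<close>. This needs
    \<open>5 * m n \<le> d\<close>.\<close>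
  have "\<forall>\<^sub>F n in sequentially. m n < d / 5"
    using order_tendstoD(2)[OF m(1), of "d / 5"] d(1) by simp
  then show ?thesis
    using evS c[of x]
  proof eventually_elim
    case (elim n)
    have m0: "0 \<le> m n" using m(2)[of n] by simp
    show ?case
    proof
      assume "cball (c n x) (3 * m n) \<subseteq> convex hull (c n ` S)"
      then have "cball (c n x) (3 * m n - m n) \<subseteq> convex hull S"
        by (rule cball_subset_convex_hull_near[rotated 3]) (use fin elim m0 in auto)
      moreover have "cball x (m n) \<subseteq> cball (c n x) (3 * m n - m n)"
        using elim by (simp add: cball_subset_cball_iff dist_commute)
      ultimately show "x \<in> interior (convex hull S)"
        using m(2)[of n] by (auto simp: mem_interior_cball)
    next
      assume "x \<in> interior (convex hull S)"
      then have "cball x (d - m n) \<subseteq> convex hull (c n ` S)"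
        by (intro cball_subset_convex_hull_near[OF _ _ _ d(2)])
          (use fin elim m0 in \<open>auto simp: dist_commute\<close>)
      moreover have "cball (c n x) (3 * m n) \<subseteq> cball x (d - m n)"
        using elim by (simp add: cball_subset_cball_iff)
      ultimately show "cball (c n x) (3 * m n) \<subseteq> convex hull (c n ` S)"
        by blast
    qed
  qed
qed

text \<open>The extreme points of the hull belong to \<open>S\<close> and are not interior, so they
  survive the removal. By Krein-Milman they generate the hull.\<close>

lemma convex_hull_remove_interior_points:
  fixes S :: "'a::euclidean_space set"
  assumes "finite S" "T \<subseteq> interior (convex hull S)"
  shows "convex hull (S - T) = convex hull S"
proof
  show "convex hull (S - T) \<subseteq> convex hull S"
    by (rule hull_mono) auto
  have "{x. x extreme_point_of convex hull S} \<subseteq> S - T"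
    using extreme_points_of_convex_hull[of S] extreme_point_not_in_interior assms(2) by blast
  then show "convex hull S \<subseteq> convex hull (S - T)"
    using Krein_Milman_polytope[OF assms(1)] hull_mono by metis
qed

section \<open>Finite-valued Borel approximation of the identity\<close>

text \<open>For positive \<open>n\<close> each coordinate is rounded down to a multiple of
  \<open>1 / n\<close> and truncated to the interval from \<open>-n\<close> to \<open>n\<close>.
  Truncation makes the range finite; at a fixed \<open>x\<close> it is inactive for large
  \<open>n\<close>, so the error bound is claimed only eventually.\<close>

lemma exists_finite_range_discretisation:
  obtains c :: "nat \<Rightarrow> 'a::euclidean_space \<Rightarrow> 'a" and m :: "nat \<Rightarrow> real"
  where "\<And>n. c n \<in> borel_measurable borel" "\<And>n. finite (range (c n))"
    "m \<longlonglongrightarrow> 0" "\<And>n. 0 < m n"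
    "\<And>x. \<forall>\<^sub>F n in sequentially. dist (c n x) x \<le> m n"
proof
  define h :: "nat \<Rightarrow> real \<Rightarrow> real"
    where "h = (\<lambda>n r. max (- real n) (min (real n) (real_of_int \<lfloor>real n * r\<rfloor> / real n)))"
  define c :: "nat \<Rightarrow> 'a \<Rightarrow> 'a" where "c = (\<lambda>n x. \<Sum>b\<in>Basis. h n (x \<bullet> b) *\<^sub>R b)"
  \<comment> \<open>Each of the \<open>DIM('a)\<close> coordinates contributes an error of at most
    \<open>1 / n\<close>; \<open>max 1 n\<close> keeps \<open>m 0\<close> positive.\<close>
  define m :: "nat \<Rightarrow> real" where "m = (\<lambda>n. real DIM('a) / real (max 1 n))"
  show "c n \<in> borel_measurable borel" for n
    unfolding c_def h_def by measurable
  show "finite (range (c n))" for n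
  proof -
    \<comment> \<open>The values are the two truncation bounds and the fractions
      \<open>k / n\<close> of modulus at most \<open>n\<close>, for which \<open>k\<close> lies
      between \<open>- n^2\<close> and \<open>n^2\<close>.\<close>
    let ?H = "insert (- real n) (insert (real n)
      ((\<lambda>k. real_of_int k / real n) ` {- (int n)\<^sup>2..(int n)\<^sup>2}))"
    have h: "h n r \<in> ?H" for r
    proof (cases "n = 0")
      case False
      let ?q = "real_of_int \<lfloor>real n * r\<rfloor> / real n"
      show ?thesis
      proof (cases "- real n \<le> ?q \<and> ?q \<le> real n")
        case True
        then have "- (real n)\<^sup>2 \<le> real_of_int \<lfloor>real n * r\<rfloor>" "real_of_int \<lfloor>real n * r\<rfloor> \<le> (real n)\<^sup>2"
          using False by (auto simp: field_simps power2_eq_square)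
        then have "- (int n)\<^sup>2 \<le> \<lfloor>real n * r\<rfloor>" "\<lfloor>real n * r\<rfloor> \<le> (int n)\<^sup>2"
          by (metis of_int_le_iff of_int_minus of_int_of_nat_eq of_int_power)+
        moreover have "h n r = ?q" using True by (simp add: h_def)
        ultimately show ?thesis by auto
      qed (auto simp: h_def max_def min_def)
    qed (simp add: h_def)
    have "range (c n) \<subseteq> (\<lambda>g. \<Sum>b\<in>Basis. g b *\<^sub>R b) ` (Basis \<rightarrow>\<^sub>E ?H)"
    proof
      fix y assume "y \<in> range (c n)"
      then obtain x where x: "y = c n x" by blast
      have "y = (\<lambda>g. \<Sum>b\<in>Basis. g b *\<^sub>R b) (restrict (\<lambda>b. h n (x \<bullet> b)) Basis)"
        unfolding x c_def by (simp cong: sum.cong)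
      moreover have "restrict (\<lambda>b. h n (x \<bullet> b)) Basis \<in> Basis \<rightarrow>\<^sub>E ?H"
        using h by (intro restrict_PiE_iff[THEN iffD2]) blast
      ultimately show "y \<in> (\<lambda>g. \<Sum>b\<in>Basis. g b *\<^sub>R b) ` (Basis \<rightarrow>\<^sub>E ?H)"
        by blast
    qed
    moreover have "finite (Basis \<rightarrow>\<^sub>E ?H :: ('a \<Rightarrow> real) set)"
      by (intro finite_PiE) auto
    ultimately show ?thesis
      using finite_surj by blast
  qed
  have "(\<lambda>n. real DIM('a) / real n) \<longlonglongrightarrow> 0"
    by (rule lim_const_over_n)
  then show "m \<longlonglongrightarrow> 0"
    by (rule Lim_transform_eventually)
      (auto simp: m_def eventually_sequentially intro!: exI[of _ 1])
  show "0 < m n" for n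
    by (simp add: m_def)
  fix x :: 'a
  \<comment> \<open>The extra 1 leaves room for rounding down: from index \<open>k\<close> on, the
    rounded coordinates stay between \<open>-n\<close> and \<open>n\<close>.\<close>
  obtain k :: nat where k: "norm x + 1 \<le> real k"
    using real_arch_simple by blast
  show "\<forall>\<^sub>F n in sequentially. dist (c n x) x \<le> m n"
    unfolding eventually_sequentially
  proof (intro exI[of _ "max 1 k"] allI impI)
    fix n assume n: "max 1 k \<le> n"
    then have n1: "1 \<le> real n" by simp
    have h: "\<bar>h n (x \<bullet> b) - x \<bullet> b\<bar> \<le> 1 / real n" if "b \<in> Basis" for b
    proof -
      let ?q = "real_of_int \<lfloor>real n * (x \<bullet> b)\<rfloor> / real n"
      have "\<bar>x \<bullet> b\<bar> \<le> real n - 1"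
        using Basis_le_norm[OF that, of x] k n by linarith
      moreover have "x \<bullet> b - 1 / real n \<le> ?q" "?q \<le> x \<bullet> b"
      proof -
        have "real n * (x \<bullet> b) - 1 \<le> real_of_int \<lfloor>real n * (x \<bullet> b)\<rfloor>"
          "real_of_int \<lfloor>real n * (x \<bullet> b)\<rfloor> \<le> real n * (x \<bullet> b)"
          by linarith+
        then show "x \<bullet> b - 1 / real n \<le> ?q" "?q \<le> x \<bullet> b"
          using n1 divide_right_mono[of "real n * (x \<bullet> b) - 1" _ "real n"]
            divide_right_mono[of _ "real n * (x \<bullet> b)" "real n"]
          by (auto simp: diff_divide_distrib)
      qed
      moreover have "1 / real n \<le> 1"
        using n1 by simp
      ultimately show ?thesis
        unfolding h_def by linarith
    qed
    have "dist (c n x) x = norm (\<Sum>b\<in>Basis. (h n (x \<bullet> b) - x \<bullet> b) *\<^sub>R b)"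
      by (simp add: c_def dist_norm scaleR_diff_left sum_subtractf euclidean_representation)
    also have "\<dots> \<le> (\<Sum>b\<in>(Basis::'a set). 1 / real n)"
      by (rule sum_norm_le) (use h in simp)
    also have "\<dots> = m n"
      using n by (simp add: m_def max_absorb2)
    finally show "dist (c n x) x \<le> m n" .
  qed
qed

section \<open>Generating functions of independent Poisson counts\<close>

context prob_space
begin

text \<open>Splitting by the value of \<open>N\<close> gives an exponential series. The norms form
  the exponential series in \<open>norm w * p\<close>, so summation and expectation may be exchanged
  for every complex \<open>w\<close>.\<close>

lemma poisson_generating_function:
  fixes w :: complex
  assumes [measurable]: "N \<in> measurable M (count_space UNIV)"
    and dist: "\<And>k::nat. prob {\<omega>\<in>space M. N \<omega> = k} = p ^ k / fact k * exp (- p)"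
  shows "integrable M (\<lambda>\<omega>. w ^ N \<omega>)"
    and "expectation (\<lambda>\<omega>. w ^ N \<omega>) = exp ((w - 1) * of_real p)"
proof -
  define f where "f = (\<lambda>k \<omega>. indicator {\<omega>\<in>space M. N \<omega> = k} \<omega> *\<^sub>R w ^ k)"
  have f_eq: "f k \<omega> = (if k = N \<omega> then w ^ k else 0)" if "\<omega> \<in> space M" for k \<omega>
    using that by (auto simp: f_def)
  have f: "(\<lambda>k. f k \<omega>) sums w ^ N \<omega>" if "\<omega> \<in> space M" for \<omega>
    unfolding f_eq[OF that] by (rule sums_single)
  have fn: "summable (\<lambda>k. norm (f k \<omega>))" if "\<omega> \<in> space M" for \<omega>
    by (rule summable_finite[of "{N \<omega>}"]) (auto simp: f_eq[OF that])
  have int: "integrable M (f k)" for k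
    unfolding f_def by (intro integrable_indicator) (auto simp: emeasure_eq_measure)
  have Ef: "integral\<^sup>L M (f k) = of_real (exp (- p)) * ((w * of_real p) ^ k /\<^sub>R fact k)" for k
    unfolding f_def by (simp add: dist scaleR_conv_of_real power_mult_distrib field_simps)
  have "(\<lambda>k. integral\<^sup>L M (f k)) sums (of_real (exp (- p)) * exp (w * of_real p))"
    unfolding Ef by (intro sums_mult exp_converges)
  also have "of_real (exp (- p)) * exp (w * of_real p) = exp ((w - 1) * of_real p)"
    by (simp add: algebra_simps exp_diff exp_minus field_simps flip: exp_of_real)
  finally have sums: "(\<lambda>k. integral\<^sup>L M (f k)) sums exp ((w - 1) * of_real p)" .
  have En: "(\<integral>\<omega>. norm (f k \<omega>) \<partial>M) = exp (- p) * ((norm w * p) ^ k /\<^sub>R fact k)" for k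
    unfolding f_def by (simp add: dist norm_power power_mult_distrib field_simps)
  have summ: "summable (\<lambda>k. \<integral>\<omega>. norm (f k \<omega>) \<partial>M)"
    unfolding En by (intro summable_mult summable_exp_generic)
  have AE: "AE \<omega> in M. summable (\<lambda>k. norm (f k \<omega>))"
    using fn by auto
  have eq: "(\<Sum>k. f k \<omega>) = w ^ N \<omega>" if "\<omega> \<in> space M" for \<omega>
    using f[OF that] by (simp add: sums_iff)
  show "integrable M (\<lambda>\<omega>. w ^ N \<omega>)"
    using integrable_suminf[OF int AE summ] by (simp add: eq cong: Bochner_Integration.integrable_cong)
  show "expectation (\<lambda>\<omega>. w ^ N \<omega>) = exp ((w - 1) * of_real p)"
    using sums_unique2[OF sums sums_integral[OF int AE summ]]
    by (simp add: eq cong: Bochner_Integration.integral_cong)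
qed

text \<open>\<open>inn T\<close> stands for the inner cells when \<open>T\<close> is the set of
  occupied cells. The two hypotheses on \<open>inn\<close> say that neither removing nor adding
  inner cells changes it. Hence the event that \<open>K\<close> is the set of occupied cells that
  are not inner puts separate conditions on single cells and none on the cells in
  \<open>inn K\<close>.\<close>

lemma poisson_cells_identity:
  fixes N :: "'i \<Rightarrow> 'a \<Rightarrow> nat" and inn :: "'i set \<Rightarrow> 'i set" and w :: complex
  assumes J: "finite J"
    and indep: "indep_vars (\<lambda>_. count_space UNIV) N J"
    and dist: "\<And>i k. i \<in> J \<Longrightarrow> prob {\<omega>\<in>space M. N i \<omega> = k} = p i ^ k / fact k * exp (- p i)"
    and inn_diff: "\<And>T. T \<subseteq> J \<Longrightarrow> inn (T - inn T) = inn T"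
    and inn_Un: "\<And>K T. K \<subseteq> T \<Longrightarrow> T \<subseteq> K \<union> inn K \<Longrightarrow> T \<subseteq> J \<Longrightarrow> inn T = inn K"
  defines "occ \<equiv> \<lambda>\<omega>. {i\<in>J. 0 < N i \<omega>}"
  shows "expectation (\<lambda>\<omega>. w ^ (\<Sum>i\<in>J \<inter> inn (occ \<omega>). N i \<omega>))
    = expectation (\<lambda>\<omega>. exp ((w - 1) * of_real (\<Sum>i\<in>J \<inter> inn (occ \<omega>). p i)))"
proof -
  define \<K> where "\<K> = {K. K \<subseteq> J \<and> K \<inter> inn K = {}}"
  \<comment> \<open>The factor of cell \<open>i\<close> for a given \<open>K\<close>: cells of
    \<open>K\<close> must be occupied, inner cells are free and carry the weight
    \<open>w ^ k\<close>, all others must be empty. For \<open>w = 1\<close> the product over the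
    cells is the indicator of the event belonging to \<open>K\<close>.\<close>
  define f :: "complex \<Rightarrow> 'i set \<Rightarrow> 'i \<Rightarrow> nat \<Rightarrow> complex" where
    "f = (\<lambda>w K i k. if i \<in> K then (if 0 < k then 1 else 0)
                    else if i \<in> inn K then w ^ k else (if k = 0 then 1 else 0))"
  have fin: "finite \<K>"
    unfolding \<K>_def using J by auto
  have out: "occ \<omega> - inn (occ \<omega>) \<in> \<K>" for \<omega>
    using inn_diff[of "occ \<omega>"] by (auto simp: \<K>_def occ_def)
  have prod_f: "(\<Prod>i\<in>J. f w K i (N i \<omega>)) =
      (if K = occ \<omega> - inn (occ \<omega>) then w ^ (\<Sum>i\<in>J \<inter> inn (occ \<omega>). N i \<omega>) else 0)"
    if K: "K \<in> \<K>" for w K \<omega>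
  \<comment> \<open>The case condition describes the event cell by cell; it is shown to be
    equivalent to \<open>K = occ \<omega> - inn (occ \<omega>)\<close>.\<close>
  proof (cases "(\<forall>i\<in>K. 0 < N i \<omega>) \<and> (\<forall>i\<in>J - K - inn K. N i \<omega> = 0)")
    case True
    have sub: "K \<subseteq> occ \<omega>" "occ \<omega> \<subseteq> K \<union> inn K"
      using True K by (auto simp: \<K>_def occ_def)
    then have inn: "inn (occ \<omega>) = inn K"
      by (intro inn_Un) (auto simp: occ_def)
    have "K = occ \<omega> - inn (occ \<omega>)"
      using sub K unfolding inn \<K>_def by blast
    moreover have "(\<Prod>i\<in>J. f w K i (N i \<omega>)) = (\<Prod>i\<in>J. if i \<in> inn K then w ^ N i \<omega> else 1)"
      using True K by (intro prod.cong) (auto simp: f_def \<K>_def)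
    moreover have "\<dots> = w ^ (\<Sum>i\<in>J \<inter> inn (occ \<omega>). N i \<omega>)"
      using J by (simp add: prod.inter_restrict[symmetric] power_sum inn)
    ultimately show ?thesis by simp
  next
    case False
    then obtain i where "i \<in> J" "f w K i (N i \<omega>) = 0"
      using K by (auto simp: f_def \<K>_def split: if_splits)
    then have "(\<Prod>i\<in>J. f w K i (N i \<omega>)) = 0"
      using J by (intro prod_zero) auto
    moreover have "K \<noteq> occ \<omega> - inn (occ \<omega>)"
    proof
      assume eq: "K = occ \<omega> - inn (occ \<omega>)"
      then have "inn K = inn (occ \<omega>)"
        using inn_diff[of "occ \<omega>"] by (auto simp: occ_def)
      with eq False show False by (auto simp: occ_def)
    qed
    ultimately show ?thesis by simp
  qed
  have meas: "N i \<in> measurable M (count_space UNIV)" if "i \<in> J" for i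
    using indep that by (simp add: indep_vars_def2)
  have int_f: "integrable M (\<lambda>\<omega>. f w K i (N i \<omega>))" if i: "i \<in> J" for w K i
  proof -
    note [measurable] = meas[OF i]
    show ?thesis
    proof (cases "i \<notin> K \<and> i \<in> inn K")
      case True
      then show ?thesis
        using poisson_generating_function(1)[OF meas[OF i] dist[OF i]] by (simp add: f_def)
    next
      case False
      then show ?thesis
        by (intro integrable_const_bound[where B=1]) (auto simp: f_def)
    qed
  qed
  have indep_f: "indep_vars (\<lambda>_. borel) (\<lambda>i \<omega>. f w K i (N i \<omega>)) J" for w K
    by (rule indep_vars_compose2[OF indep]) simp
  have int_prod: "integrable M (\<lambda>\<omega>. \<Prod>i\<in>J. f w K i (N i \<omega>))" for w K
    by (rule indep_vars_integrable[OF J indep_f int_f])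
  \<comment> \<open>Only factors of inner cells depend on \<open>w\<close>. There \<open>f 1\<close>
    is constantly 1, and the generating function supplies the exponential.\<close>
  have E_f: "expectation (\<lambda>\<omega>. f w K i (N i \<omega>))
      = (if i \<in> inn K then exp ((w - 1) * of_real (p i)) else 1) * expectation (\<lambda>\<omega>. f 1 K i (N i \<omega>))"
    if i: "i \<in> J" and K: "K \<in> \<K>" for w K i
  proof (cases "i \<in> inn K")
    case True
    then have "i \<notin> K" using K by (auto simp: \<K>_def)
    then show ?thesis
      using True poisson_generating_function(2)[OF meas[OF i] dist[OF i]]
      by (simp add: f_def prob_space)
  qed (simp add: f_def cong: if_cong)
  have E_prod: "expectation (\<lambda>\<omega>. \<Prod>i\<in>J. f w K i (N i \<omega>))
      = exp ((w - 1) * of_real (\<Sum>i\<in>J \<inter> inn K. p i)) * expectation (\<lambda>\<omega>. \<Prod>i\<in>J. f 1 K i (N i \<omega>))"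
    if K: "K \<in> \<K>" for K
  proof -
    have "expectation (\<lambda>\<omega>. \<Prod>i\<in>J. f w K i (N i \<omega>)) = (\<Prod>i\<in>J. expectation (\<lambda>\<omega>. f w K i (N i \<omega>)))"
      by (rule indep_vars_lebesgue_integral[OF J indep_f int_f])
    also have "\<dots> = (\<Prod>i\<in>J. if i \<in> inn K then exp ((w - 1) * of_real (p i)) else 1) *
        (\<Prod>i\<in>J. expectation (\<lambda>\<omega>. f 1 K i (N i \<omega>)))"
      unfolding prod.distrib[symmetric] by (intro prod.cong refl E_f K)
    also have "(\<Prod>i\<in>J. if i \<in> inn K then exp ((w - 1) * of_real (p i)) else 1)
        = exp ((w - 1) * of_real (\<Sum>i\<in>J \<inter> inn K. p i))"
      using J by (simp add: prod.inter_restrict[symmetric] exp_sum sum_distrib_left)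
    also have "(\<Prod>i\<in>J. expectation (\<lambda>\<omega>. f 1 K i (N i \<omega>))) = expectation (\<lambda>\<omega>. \<Prod>i\<in>J. f 1 K i (N i \<omega>))"
      by (rule indep_vars_lebesgue_integral[OF J indep_f int_f, symmetric])
    finally show ?thesis .
  qed
  \<comment> \<open>For each \<open>\<omega>\<close> exactly one \<open>K\<close> in
    \<open>\<K>\<close> contributes to the sum.\<close>
  have "expectation (\<lambda>\<omega>. w ^ (\<Sum>i\<in>J \<inter> inn (occ \<omega>). N i \<omega>))
      = expectation (\<lambda>\<omega>. \<Sum>K\<in>\<K>. \<Prod>i\<in>J. f w K i (N i \<omega>))"
    using out fin by (simp add: prod_f)
  also have "\<dots> = (\<Sum>K\<in>\<K>. exp ((w - 1) * of_real (\<Sum>i\<in>J \<inter> inn K. p i)) *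
      expectation (\<lambda>\<omega>. \<Prod>i\<in>J. f 1 K i (N i \<omega>)))"
    using int_prod E_prod by (simp add: Bochner_Integration.integral_sum)
  \<comment> \<open>The sum is reassembled at weight 1, where the products are indicators that
    select the exponential of the actual \<open>K\<close>.\<close>
  also have "\<dots> = expectation (\<lambda>\<omega>. \<Sum>K\<in>\<K>. exp ((w - 1) * of_real (\<Sum>i\<in>J \<inter> inn K. p i)) *
      (\<Prod>i\<in>J. f 1 K i (N i \<omega>)))"
    using int_prod by (subst Bochner_Integration.integral_sum) auto
  also have "\<dots> = expectation (\<lambda>\<omega>. exp ((w - 1) * of_real (\<Sum>i\<in>J \<inter> inn (occ \<omega>). p i)))"
  proof (intro Bochner_Integration.integral_cong refl)
    fix \<omega>
    let ?e = "\<lambda>K. exp ((w - 1) * of_real (\<Sum>i\<in>J \<inter> inn K. p i))"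
    have "(\<Sum>K\<in>\<K>. ?e K * (\<Prod>i\<in>J. f 1 K i (N i \<omega>)))
        = (\<Sum>K\<in>\<K>. if K = occ \<omega> - inn (occ \<omega>) then ?e K else 0)"
      by (intro sum.cong refl) (simp add: prod_f)
    also have "\<dots> = ?e (occ \<omega> - inn (occ \<omega>))"
      using out fin by simp
    also have "\<dots> = ?e (occ \<omega>)"
      by (simp add: inn_diff occ_def)
    finally show "(\<Sum>K\<in>\<K>. ?e K * (\<Prod>i\<in>J. f 1 K i (N i \<omega>))) = ?e (occ \<omega>)" .
  qed
  finally show ?thesis .
qed

end

section \<open>The identity for the discretised process\<close>

text \<open>The cells are the fibres of \<open>c\<close>, and \<open>In \<omega>\<close> is a union
  of cells determined by which cells are occupied. Everything is thus a function of finitely many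
  independent Poisson counts, and \<open>poisson_cells_identity\<close> applies.\<close>

lemma poisson_point_process_discretised:
  fixes \<nu> :: "'a::euclidean_space measure" and \<eta> :: "'b \<Rightarrow> 'a set" and c :: "'a \<Rightarrow> 'a" and w :: complex
  assumes ppp: "poisson_point_process M \<nu> \<eta>"
    and \<nu>: "finite_measure \<nu>" "sets \<nu> = sets borel"
    and c: "c \<in> borel_measurable borel" "finite (range c)"
    and \<epsilon>: "0 < \<epsilon>"
  defines "In \<equiv> \<lambda>\<omega>. {x. cball (c x) \<epsilon> \<subseteq> convex hull (c ` \<eta> \<omega>)}"
  shows "(\<lambda>\<omega>. card (\<eta> \<omega> \<inter> In \<omega>)) \<in> measurable M (count_space UNIV)"
    and "(\<lambda>\<omega>. measure \<nu> (In \<omega>)) \<in> borel_measurable M"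
    and "(\<integral>\<omega>. w ^ card (\<eta> \<omega> \<inter> In \<omega>) \<partial>M) = (\<integral>\<omega>. exp ((w - 1) * of_real (measure \<nu> (In \<omega>))) \<partial>M)"
proof -
  interpret prob_space M
    using ppp by (simp add: poisson_point_process_def)
  interpret \<nu>: finite_measure \<nu> by fact
  \<comment> \<open>The values of \<open>c\<close> are numbered because
    \<open>poisson_point_process\<close> states independence for families indexed by natural
    numbers.\<close>
  obtain k :: nat and r where r: "range c = r ` {i. i < k}" "inj_on r {i. i < k}"
    using finite_imp_nat_seg_image_inj_on[OF c(2)] by blast
  define J where "J = {i. i < k}"
  have J: "finite J" by (simp add: J_def)
  have inj_r: "r i = r j \<longleftrightarrow> i = j" if "i \<in> J" "j \<in> J" for i j
    using r(2) that by (auto simp: J_def inj_on_def)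
  obtain j where j: "\<And>x. j x \<in> J" "\<And>x. c x = r (j x)"
  proof -
    have "\<forall>x. \<exists>i. i \<in> J \<and> c x = r i"
      using r(1) by (auto simp: J_def)
    then show ?thesis using that by metis
  qed
  define N where "N = (\<lambda>i \<omega>. card (\<eta> \<omega> \<inter> c -` {r i}))"
  \<comment> \<open>Indices outside \<open>J\<close>, where \<open>r\<close> is arbitrary, may also
    belong to \<open>inn K\<close>; intersections with \<open>J\<close> discard them later.\<close>
  define inn where "inn = (\<lambda>K. {i. cball (r i) \<epsilon> \<subseteq> convex hull (r ` K)})"
  define occ where "occ = (\<lambda>\<omega>. {i\<in>J. 0 < N i \<omega>})"
  have fin: "finite (\<eta> \<omega>)" if "\<omega> \<in> space M" for \<omega>
    using ppp that by (simp add: poisson_point_process_def)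
  have cell: "c -` {r i} \<in> sets borel" for i
    using measurable_sets_borel[OF c(1), of "{r i}"] by simp
  have N_meas [measurable]: "N i \<in> measurable M (count_space UNIV)" for i
    using ppp cell by (simp add: poisson_point_process_def N_def)
  have N_dist: "prob {\<omega>\<in>space M. N i \<omega> = l} = measure \<nu> (c -` {r i}) ^ l / fact l * exp (- measure \<nu> (c -` {r i}))"
    for i l
    using ppp cell by (simp add: poisson_point_process_def N_def)
  have indep: "indep_vars (\<lambda>_. count_space UNIV) N J"
  proof -
    have "disjoint_family_on (\<lambda>i. c -` {r i}) J"
      using inj_r by (auto simp: disjoint_family_on_def)
    moreover have "\<forall>(I::nat set) A. finite I \<longrightarrow> (\<forall>i\<in>I. A i \<in> sets borel) \<longrightarrow> disjoint_family_on A I \<longrightarrow>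
        indep_vars (\<lambda>_. count_space UNIV) (\<lambda>i \<omega>. card (\<eta> \<omega> \<inter> A i)) I"
      using ppp by (simp add: poisson_point_process_def)
    ultimately show ?thesis
      using cell J unfolding N_def by (elim allE impE) auto
  qed
  have occ_image: "r ` occ \<omega> = c ` \<eta> \<omega>" if \<omega>: "\<omega> \<in> space M" for \<omega>
  proof -
    have "occ \<omega> = {i\<in>J. r i \<in> c ` \<eta> \<omega>}"
      using fin[OF \<omega>] by (auto simp: occ_def N_def card_gt_0_iff intro: rev_image_eqI)
    moreover have "c x \<in> r ` {i\<in>J. r i \<in> c ` \<eta> \<omega>}" if "x \<in> \<eta> \<omega>" for x
      by (rule image_eqI[of _ _ "j x"]) (use that j[of x] in \<open>auto simp flip: j(2)\<close>)
    ultimately show ?thesis by blast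
  qed
  \<comment> \<open>Since \<open>\<epsilon>\<close> is positive, representatives of inner cells are
    interior points of the hull, so removing them preserves it.\<close>
  have inn_diff: "inn (T - inn T) = inn T" if "T \<subseteq> J" for T
  proof -
    let ?X = "{x. cball x \<epsilon> \<subseteq> convex hull (r ` T)}"
    have "r ` (T - inn T) = r ` T - ?X"
      by (auto simp: inn_def)
    moreover have "convex hull (r ` T - ?X) = convex hull (r ` T)"
      using finite_subset[OF that J] \<epsilon>
      by (intro convex_hull_remove_interior_points) (auto simp: mem_interior_cball)
    ultimately show ?thesis by (simp add: inn_def)
  qed
  \<comment> \<open>The representatives added to those of \<open>K\<close> already lie in the hull
    of the latter.\<close>
  have inn_Un: "inn T = inn K" if "K \<subseteq> T" "T \<subseteq> K \<union> inn K" for K T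
  proof -
    have "r i \<in> convex hull (r ` K)" if "i \<in> inn K" for i
      using that \<epsilon> by (force simp: inn_def)
    then have "r ` T \<subseteq> convex hull (r ` K)"
      using \<open>T \<subseteq> K \<union> inn K\<close> by (auto intro: hull_inc)
    then have "convex hull (r ` T) = convex hull (r ` K)"
      using hull_minimal[of "r ` T" "convex hull (r ` K)" convex] hull_mono[OF image_mono[OF that(1)], of convex r]
      by (intro equalityI) auto
    then show ?thesis by (simp add: inn_def)
  qed
  have In_eq: "In \<omega> = (\<Union>i\<in>J \<inter> inn (occ \<omega>). c -` {r i})" if \<omega>: "\<omega> \<in> space M" for \<omega>
    unfolding In_def inn_def occ_image[OF \<omega>] using j by auto
  have card_eq: "card (\<eta> \<omega> \<inter> In \<omega>) = (\<Sum>i\<in>J \<inter> inn (occ \<omega>). N i \<omega>)" if \<omega>: "\<omega> \<in> space M" for \<omega>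
    unfolding In_eq[OF \<omega>] Int_UN_distrib N_def
    by (rule card_UN_disjoint) (use J fin[OF \<omega>] inj_r in auto)
  have measure_eq: "measure \<nu> (In \<omega>) = (\<Sum>i\<in>J \<inter> inn (occ \<omega>). measure \<nu> (c -` {r i}))"
    if \<omega>: "\<omega> \<in> space M" for \<omega>
    unfolding In_eq[OF \<omega>]
    by (rule \<nu>.finite_measure_finite_Union)
      (use J inj_r cell \<nu>(2) in \<open>auto simp: disjoint_family_on_def\<close>)
  \<comment> \<open>\<open>occ\<close> takes finitely many values, each described by finitely many
    counts, so every predicate of it is measurable.\<close>
  have [measurable]: "Measurable.pred M (\<lambda>\<omega>. P (occ \<omega>))" for P
  proof -
    have "P (occ \<omega>) \<longleftrightarrow> (\<exists>K\<in>{K\<in>Pow J. P K}. \<forall>i\<in>J. 0 < N i \<omega> \<longleftrightarrow> i \<in> K)" for \<omega>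
    proof
      assume "\<exists>K\<in>{K\<in>Pow J. P K}. \<forall>i\<in>J. 0 < N i \<omega> \<longleftrightarrow> i \<in> K"
      then obtain K where K: "K \<subseteq> J" "P K" "\<forall>i\<in>J. 0 < N i \<omega> \<longleftrightarrow> i \<in> K" by blast
      then have "occ \<omega> = K" by (auto simp: occ_def)
      with K show "P (occ \<omega>)" by simp
    next
      assume "P (occ \<omega>)"
      then show "\<exists>K\<in>{K\<in>Pow J. P K}. \<forall>i\<in>J. 0 < N i \<omega> \<longleftrightarrow> i \<in> K"
        by (intro bexI[of _ "occ \<omega>"]) (auto simp: occ_def)
    qed
    moreover have "Measurable.pred M (\<lambda>\<omega>. \<exists>K\<in>{K\<in>Pow J. P K}. \<forall>i\<in>J. 0 < N i \<omega> \<longleftrightarrow> i \<in> K)"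
      using J by (intro pred_intros_finite) auto
    ultimately show ?thesis by simp
  qed
  have "(\<lambda>\<omega>. \<Sum>i\<in>J. if i \<in> inn (occ \<omega>) then N i \<omega> else 0) \<in> measurable M (count_space UNIV)"
    by measurable
  then show "(\<lambda>\<omega>. card (\<eta> \<omega> \<inter> In \<omega>)) \<in> measurable M (count_space UNIV)"
    using J by (subst measurable_cong[OF card_eq]) (simp_all add: sum.inter_restrict)
  have "(\<lambda>\<omega>. \<Sum>i\<in>J. if i \<in> inn (occ \<omega>) then measure \<nu> (c -` {r i}) else 0) \<in> borel_measurable M"
    by measurable
  then show "(\<lambda>\<omega>. measure \<nu> (In \<omega>)) \<in> borel_measurable M"
    using J by (subst measurable_cong[OF measure_eq]) (simp_all add: sum.inter_restrict)
  have "(\<integral>\<omega>. w ^ card (\<eta> \<omega> \<inter> In \<omega>) \<partial>M) = expectation (\<lambda>\<omega>. w ^ (\<Sum>i\<in>J \<inter> inn (occ \<omega>). N i \<omega>))"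
    by (intro Bochner_Integration.integral_cong) (simp_all add: card_eq)
  also have "\<dots> = expectation (\<lambda>\<omega>. exp ((w - 1) *
      of_real (\<Sum>i\<in>J \<inter> inn (occ \<omega>). measure \<nu> (c -` {r i}))))"
    unfolding occ_def
    by (rule poisson_cells_identity[OF J indep N_dist inn_diff inn_Un])
  also have "\<dots> = (\<integral>\<omega>. exp ((w - 1) * of_real (measure \<nu> (In \<omega>))) \<partial>M)"
    by (intro Bochner_Integration.integral_cong) (simp_all add: measure_eq)
  finally show "(\<integral>\<omega>. w ^ card (\<eta> \<omega> \<inter> In \<omega>) \<partial>M) = (\<integral>\<omega>. exp ((w - 1) * of_real (measure \<nu> (In \<omega>))) \<partial>M)" .
qed

section \<open>Null frontiers and entire generating functions\<close>

text \<open>The frontier of a convex set is Lebesgue negligible; being closed, it is a Borel null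
  set, and absolute continuity carries this over to \<open>\<mu>\<close>.\<close>

lemma measure_interior_convex:
  fixes \<mu> :: "'a::euclidean_space measure"
  assumes "sets \<mu> = sets borel" "absolutely_continuous lborel \<mu>" "convex C" "closed C"
  shows "measure \<mu> (interior C) = measure \<mu> C"
proof -
  have "frontier C \<in> null_sets lebesgue"
    using negligible_convex_frontier[OF assms(3)] by (simp add: negligible_iff_null_sets)
  then have "frontier C \<in> null_sets lborel"
    by (simp add: null_sets_completion_iff frontier_closed)
  then have "frontier C \<in> null_sets \<mu>"
    using assms(2) by (auto simp: absolutely_continuous_def)
  moreover have "interior C = C - frontier C"
    using assms(4) interior_subset by (auto simp: frontier_def)
  ultimately show ?thesis
    using assms(1,4) by (simp add: measure_Diff_null_set)
qed

text \<open>The expectation is the power series with coefficients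
  \<open>prob {\<omega>\<in>space M. I \<omega> = k}\<close>. Its partial sums are expectations
  truncated to \<open>I \<omega> < n\<close>, and dominated convergence gives convergence at every
  \<open>z\<close>.\<close>

lemma (in prob_space) holomorphic_generating_function:
  fixes I :: "'a \<Rightarrow> nat"
  assumes [measurable]: "I \<in> measurable M (count_space UNIV)"
    and int: "\<And>z::complex. integrable M (\<lambda>\<omega>. z ^ I \<omega>)"
  shows "(\<lambda>z::complex. expectation (\<lambda>\<omega>. z ^ I \<omega>)) holomorphic_on UNIV"
proof -
  have sums: "(\<lambda>k. complex_of_real (prob {\<omega>\<in>space M. I \<omega> = k}) * (z - 0) ^ k)
      sums expectation (\<lambda>\<omega>. z ^ I \<omega>)" for z
  proof -
    have "(\<Sum>k<n. complex_of_real (prob {\<omega>\<in>space M. I \<omega> = k}) * (z - 0) ^ k)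
        = expectation (\<lambda>\<omega>. if I \<omega> < n then z ^ I \<omega> else 0)" for n
    proof -
      have "(\<Sum>k<n. complex_of_real (prob {\<omega>\<in>space M. I \<omega> = k}) * (z - 0) ^ k)
          = (\<Sum>k<n. expectation (\<lambda>\<omega>. indicator {\<omega>\<in>space M. I \<omega> = k} \<omega> *\<^sub>R z ^ k))"
        by (simp add: scaleR_conv_of_real)
      also have "\<dots> = expectation (\<lambda>\<omega>. \<Sum>k<n. indicator {\<omega>\<in>space M. I \<omega> = k} \<omega> *\<^sub>R z ^ k)"
        by (rule Bochner_Integration.integral_sum[symmetric])
          (intro integrable_indicator, auto simp: emeasure_eq_measure)
      also have "\<dots> = expectation (\<lambda>\<omega>. if I \<omega> < n then z ^ I \<omega> else 0)"
      proof (intro Bochner_Integration.integral_cong refl)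
        fix \<omega> assume "\<omega> \<in> space M"
        then have "(\<Sum>k<n. indicator {\<omega>\<in>space M. I \<omega> = k} \<omega> *\<^sub>R z ^ k)
            = (\<Sum>k<n. if k = I \<omega> then z ^ k else 0)"
          by (intro sum.cong) auto
        then show "(\<Sum>k<n. indicator {\<omega>\<in>space M. I \<omega> = k} \<omega> *\<^sub>R z ^ k)
            = (if I \<omega> < n then z ^ I \<omega> else 0)"
          by simp
      qed
      finally show ?thesis .
    qed
    moreover have "(\<lambda>n. expectation (\<lambda>\<omega>. if I \<omega> < n then z ^ I \<omega> else 0))
        \<longlonglongrightarrow> expectation (\<lambda>\<omega>. z ^ I \<omega>)"
    proof (rule integral_dominated_convergence)
      show "integrable M (\<lambda>\<omega>. norm (z ^ I \<omega>))"
        using int by (rule integrable_norm)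
      have "\<forall>\<^sub>F n in sequentially. z ^ I \<omega> = (if I \<omega> < n then z ^ I \<omega> else 0)" for \<omega>
        using eventually_gt_at_top[of "I \<omega>"] by eventually_elim simp
      then show "AE \<omega> in M. (\<lambda>n. if I \<omega> < n then z ^ I \<omega> else 0) \<longlonglongrightarrow> z ^ I \<omega>"
        by (intro AE_I2) (rule Lim_transform_eventually[OF tendsto_const])
    qed auto
    ultimately show ?thesis by (simp add: sums_def)
  qed
  \<comment> \<open>Power series are holomorphic on balls around their centre; the balls around 0
    exhaust the plane.\<close>
  have "(\<lambda>z::complex. expectation (\<lambda>\<omega>. z ^ I \<omega>)) holomorphic_on ball 0 (norm z + 1)" for z :: complex
    by (rule power_series_holomorphic) (rule sums)
  then have "(\<lambda>z::complex. expectation (\<lambda>\<omega>. z ^ I \<omega>)) holomorphic_on (\<Union>z::complex. ball 0 (norm z + 1))"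
    by (intro holomorphic_on_UN_open) auto
  moreover have "(\<Union>z::complex. ball (0::complex) (norm z + 1)) = UNIV"
  proof -
    have "z \<in> ball 0 (norm z + 1)" for z :: complex by simp
    then show ?thesis by blast
  qed
  ultimately show ?thesis by simp
qed

section \<open>Passage to the limit\<close>

theorem theorem1:
  fixes \<mu> :: "'a::euclidean_space measure" and M :: "'b measure"
    and \<eta> :: "'b \<Rightarrow> 'a set" and t :: real
  assumes "prob_space \<mu>" and "sets \<mu> = sets borel" and "absolutely_continuous lborel \<mu>"
    and "t > 0"
    and "poisson_point_process M (scale_measure (ennreal t) \<mu>) \<eta>"
  defines "I \<equiv> \<lambda>\<omega>. card {x \<in> \<eta> \<omega>. x \<in> interior (convex hull (\<eta> \<omega>))}"
    and "V \<equiv> \<lambda>\<omega>. measure \<mu> (convex hull (\<eta> \<omega>))"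
  shows "(\<forall>z::complex. integrable M (\<lambda>\<omega>. z ^ I \<omega>)) \<and>
         (\<forall>z::complex. integrable M (\<lambda>\<omega>. exp (z * complex_of_real (V \<omega>)))) \<and>
         (\<lambda>z::complex. integral\<^sup>L M (\<lambda>\<omega>. z ^ I \<omega>)) holomorphic_on UNIV \<and>
         (\<lambda>z::complex. integral\<^sup>L M (\<lambda>\<omega>. exp (z * complex_of_real (V \<omega>)))) holomorphic_on UNIV \<and>
         (\<forall>z::complex. integral\<^sup>L M (\<lambda>\<omega>. (z + 1) ^ I \<omega>)
             = integral\<^sup>L M (\<lambda>\<omega>. exp (complex_of_real t * z * complex_of_real (V \<omega>))))"
proof -
  interpret \<mu>: prob_space \<mu> by fact
  let ?\<nu> = "scale_measure (ennreal t) \<mu>"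
  interpret prob_space M
    using assms(5) by (simp add: poisson_point_process_def)
  have \<nu>: "finite_measure ?\<nu>" "sets ?\<nu> = sets borel"
    using assms(2) by (auto intro!: finite_measureI simp: \<mu>.emeasure_space_1 space_scale_measure ennreal_mult_eq_top_iff)
  have measure_\<nu>: "measure ?\<nu> A = t * measure \<mu> A" for A
    using \<open>t > 0\<close> by (simp add: measure_scale_measure)
  have fin: "finite (\<eta> \<omega>)" if "\<omega> \<in> space M" for \<omega>
    using assms(5) that by (simp add: poisson_point_process_def)
  obtain c :: "nat \<Rightarrow> 'a \<Rightarrow> 'a" and m :: "nat \<Rightarrow> real"
    where c: "\<And>n. c n \<in> borel_measurable borel" "\<And>n. finite (range (c n))"
      and m: "m \<longlonglongrightarrow> 0" "\<And>n. 0 < m n"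
      and cm: "\<And>x. \<forall>\<^sub>F n in sequentially. dist (c n x) x \<le> m n"
    using exists_finite_range_discretisation by blast
  define In where "In = (\<lambda>n \<omega>. {x. cball (c n x) (3 * m n) \<subseteq> convex hull (c n ` \<eta> \<omega>)})"
  define I' where "I' = (\<lambda>n \<omega>. card (\<eta> \<omega> \<inter> In n \<omega>))"
  define V' where "V' = (\<lambda>n \<omega>. measure \<mu> (In n \<omega>))"
  have m3: "0 < 3 * m n" for n using m(2)[of n] by simp
  note discretised = poisson_point_process_discretised[OF assms(5) \<nu> c m3]
  have I'_meas [measurable]: "I' n \<in> measurable M (count_space UNIV)" for n
    unfolding I'_def In_def by (rule discretised(1))
  have V'_meas [measurable]: "V' n \<in> borel_measurable M" for n
    using borel_measurable_divide[OF discretised(2)[of n] borel_measurable_const[of t]] \<open>t > 0\<close>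
    by (simp add: V'_def In_def measure_\<nu>)
  have identity': "(\<integral>\<omega>. (z + 1) ^ I' n \<omega> \<partial>M) = (\<integral>\<omega>. exp (of_real t * z * of_real (V' n \<omega>)) \<partial>M)"
    for n and z :: complex
    using discretised(3)[of "z + 1" n] by (simp add: I'_def V'_def In_def measure_\<nu> mult_ac)

  have eventually_In: "\<forall>\<^sub>F n in sequentially. x \<in> In n \<omega> \<longleftrightarrow> x \<in> interior (convex hull \<eta> \<omega>)"
    if "\<omega> \<in> space M" for x \<omega>
    using eventually_cball_subset_discretised_hull_iff[OF fin[OF that] m cm] by (simp add: In_def)
  have I_lim: "\<forall>\<^sub>F n in sequentially. I' n \<omega> = I \<omega>" if \<omega>: "\<omega> \<in> space M" for \<omega>
  proof -
    \<comment> \<open>The threshold for \<open>n\<close> depends on the point; finiteness of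
      \<open>\<eta> \<omega>\<close> makes it uniform, so \<open>I'\<close> becomes exactly equal to
      \<open>I\<close>.\<close>
    have "\<forall>\<^sub>F n in sequentially. \<forall>x\<in>\<eta> \<omega>. x \<in> In n \<omega> \<longleftrightarrow> x \<in> interior (convex hull \<eta> \<omega>)"
      using fin[OF \<omega>] eventually_In[OF \<omega>] by (simp add: eventually_ball_finite)
    then show ?thesis
      unfolding I'_def I_def by eventually_elim (auto intro!: arg_cong[where f=card])
  qed
  have V_lim: "(\<lambda>n. V' n \<omega>) \<longlonglongrightarrow> V \<omega>" if \<omega>: "\<omega> \<in> space M" for \<omega>
  proof -
    let ?H = "convex hull \<eta> \<omega>"
    have In_sets: "In n \<omega> \<in> sets borel" for n
    proof -
      have "In n \<omega> = c n -` {y \<in> range (c n). cball y (3 * m n) \<subseteq> convex hull (c n ` \<eta> \<omega>)}"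
        by (auto simp: In_def)
      also have "\<dots> \<in> sets borel"
        using c by (intro measurable_sets_borel[OF c(1)] borel_closed finite_imp_closed) auto
      finally show ?thesis .
    qed
    \<comment> \<open>For the volume, the thresholds may vary with \<open>x\<close>: pointwise
      convergence of indicators bounded by 1 suffices, as \<open>\<mu>\<close> is finite.\<close>
    have "(\<lambda>n. \<integral>x. indicator (In n \<omega>) x \<partial>\<mu>) \<longlonglongrightarrow> (\<integral>x. indicator (interior ?H) x \<partial>\<mu> :: real)"
    proof (rule integral_dominated_convergence)
      show "AE x in \<mu>. (\<lambda>n. indicator (In n \<omega>) x :: real) \<longlonglongrightarrow> indicator (interior ?H) x"
      proof (intro AE_I2)
        fix x
        have "\<forall>\<^sub>F n in sequentially. indicator (interior ?H) x = (indicator (In n \<omega>) x :: real)"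
          using eventually_In[OF \<omega>, of x] by eventually_elim (simp add: indicator_def)
        then show "(\<lambda>n. indicator (In n \<omega>) x :: real) \<longlonglongrightarrow> indicator (interior ?H) x"
          by (rule Lim_transform_eventually[OF tendsto_const])
      qed
      show "integrable \<mu> (\<lambda>x. 1 :: real)" by simp
    qed (use In_sets assms(2) in \<open>auto intro!: borel_measurable_indicator split: split_indicator\<close>)
    then have "(\<lambda>n. measure \<mu> (In n \<omega>)) \<longlonglongrightarrow> measure \<mu> (interior ?H)"
      using In_sets assms(2) sets_eq_imp_space_eq[OF assms(2)] by simp
    moreover have "measure \<mu> (interior ?H) = measure \<mu> ?H"
      using assms(2,3) fin[OF \<omega>]
      by (intro measure_interior_convex) (auto intro: compact_imp_closed finite_imp_compact_convex_hull)
    ultimately show ?thesis by (simp add: V'_def V_def)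
  qed

  have V_meas [measurable]: "V \<in> borel_measurable M"
    by (rule borel_measurable_LIMSEQ_real[OF V_lim V'_meas])
  have I_meas [measurable]: "I \<in> measurable M (count_space UNIV)"
  proof -
    \<comment> \<open>Each sequence of counts is eventually constant, so a level set of
      \<open>I\<close> is the lower limit of the level sets of \<open>I'\<close>.\<close>
    have "I \<omega> = k \<longleftrightarrow> (\<exists>n0. \<forall>n\<ge>n0. I' n \<omega> = k)" if \<omega>: "\<omega> \<in> space M" for k \<omega>
      using I_lim[OF \<omega>] by (auto simp: eventually_sequentially) (metis nle_le)+
    then have "{\<omega>\<in>space M. I \<omega> = k} = {\<omega>\<in>space M. \<exists>n0. \<forall>n\<ge>n0. I' n \<omega> = k}" for k
      by blast
    moreover have "{\<omega>\<in>space M. \<exists>n0. \<forall>n\<ge>n0. I' n \<omega> = k} \<in> sets M" for k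
      by measurable
    ultimately have "I -` {k} \<inter> space M \<in> sets M" for k
      by (simp add: vimage_def Int_def conj_commute)
    then show ?thesis
      by (simp add: measurable_count_space_eq2_countable)
  qed

  \<comment> \<open>The total number of points is Poisson and dominates \<open>I\<close> and every
    \<open>I'\<close>. A base of \<open>1 + norm z\<close>, being at least 1, turns this into an
    integrable bound for the powers.\<close>
  define N where "N = (\<lambda>\<omega>. card (\<eta> \<omega> \<inter> UNIV))"
  have N_meas: "N \<in> measurable M (count_space UNIV)"
    and N_dist: "prob {\<omega>\<in>space M. N \<omega> = k} = measure ?\<nu> UNIV ^ k / fact k * exp (- measure ?\<nu> UNIV)" for k
    using assms(5) sets.top[of borel] unfolding poisson_point_process_def N_def space_borel by blast+
  have bound_int: "integrable M (\<lambda>\<omega>. (1 + norm z) ^ N \<omega>)" for z :: complex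
    using integrable_norm[OF poisson_generating_function(1)[OF N_meas N_dist, of "of_real (1 + norm z)"]]
    by (simp add: norm_power del: of_real_add)
  have power_bound: "norm (z ^ k) \<le> (1 + norm z) ^ N \<omega>" if "k \<le> N \<omega>" for z :: complex and k \<omega>
  proof -
    have "norm (z ^ k) \<le> (1 + norm z) ^ k"
      by (simp add: norm_power power_mono)
    also have "\<dots> \<le> (1 + norm z) ^ N \<omega>"
      using that by (intro power_increasing) auto
    finally show ?thesis .
  qed
  have I'_le: "I' n \<omega> \<le> N \<omega>" and I_le: "I \<omega> \<le> N \<omega>" if "\<omega> \<in> space M" for n \<omega>
    using fin[OF that] by (auto simp: I'_def I_def N_def intro!: card_mono)
  have int_I: "integrable M (\<lambda>\<omega>. z ^ I \<omega>)" for z :: complex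
    by (rule Bochner_Integration.integrable_bound[OF bound_int[of z]])
      (use power_bound I_le in \<open>auto intro!: AE_I2 order_trans[OF _ abs_ge_self]\<close>)
  have exp_bound: "norm (exp (z * of_real v)) \<le> exp (norm z)" if "0 \<le> v" "v \<le> 1" for z :: complex and v
  proof -
    have "norm (exp (z * of_real v)) \<le> exp (norm (z * of_real v))"
      by (rule norm_exp)
    also have "\<dots> \<le> exp (norm z)"
      using that mult_left_mono[of v 1 "norm z"] by (simp add: norm_mult)
    finally show ?thesis .
  qed
  have int_V: "integrable M (\<lambda>\<omega>. exp (z * of_real (V \<omega>)))" for z :: complex
  proof (rule integrable_const_bound[where B="exp (norm z)"])
    show "AE \<omega> in M. norm (exp (z * of_real (V \<omega>))) \<le> exp (norm z)"
      by (intro AE_I2 exp_bound) (simp_all add: V_def)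
  qed measurable

  \<comment> \<open>By \<open>identity'\<close> the discretised expectations form one sequence
    written in two ways; both sides of the claim are its limit.\<close>
  have identity: "(\<integral>\<omega>. (z + 1) ^ I \<omega> \<partial>M) = (\<integral>\<omega>. exp (of_real t * z * of_real (V \<omega>)) \<partial>M)"
    for z :: complex
  proof (rule LIMSEQ_unique)
    show "(\<lambda>n. \<integral>\<omega>. (z + 1) ^ I' n \<omega> \<partial>M) \<longlonglongrightarrow> (\<integral>\<omega>. (z + 1) ^ I \<omega> \<partial>M)"
    proof (rule integral_dominated_convergence[OF _ _ bound_int[of "z + 1"]])
      show "AE \<omega> in M. (\<lambda>n. (z + 1) ^ I' n \<omega>) \<longlonglongrightarrow> (z + 1) ^ I \<omega>"
      proof (intro AE_I2)
        fix \<omega> assume "\<omega> \<in> space M"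
        from I_lim[OF this] show "(\<lambda>n. (z + 1) ^ I' n \<omega>) \<longlonglongrightarrow> (z + 1) ^ I \<omega>"
          by (intro Lim_transform_eventually[OF tendsto_const]) (auto elim: eventually_mono)
      qed
    qed (use power_bound I'_le in auto)
    have "(\<lambda>n. \<integral>\<omega>. exp (of_real t * z * of_real (V' n \<omega>)) \<partial>M)
        \<longlonglongrightarrow> (\<integral>\<omega>. exp (of_real t * z * of_real (V \<omega>)) \<partial>M)"
    proof (rule integral_dominated_convergence)
      show "integrable M (\<lambda>\<omega>. exp (norm (of_real t * z)))" by simp
      show "AE \<omega> in M. (\<lambda>n. exp (of_real t * z * of_real (V' n \<omega>))) \<longlonglongrightarrow> exp (of_real t * z * of_real (V \<omega>))"
        using V_lim by (intro AE_I2 tendsto_intros) auto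
      show "AE \<omega> in M. norm (exp (of_real t * z * of_real (V' n \<omega>))) \<le> exp (norm (of_real t * z))" for n
        by (intro AE_I2 exp_bound) (auto simp: V'_def)
    qed measurable
    then show "(\<lambda>n. \<integral>\<omega>. (z + 1) ^ I' n \<omega> \<partial>M) \<longlonglongrightarrow> (\<integral>\<omega>. exp (of_real t * z * of_real (V \<omega>)) \<partial>M)"
      by (simp add: identity')
  qed
  have hol: "(\<lambda>z::complex. \<integral>\<omega>. z ^ I \<omega> \<partial>M) holomorphic_on UNIV"
    by (rule holomorphic_generating_function[OF I_meas int_I])
  \<comment> \<open>Solving the identity for the moment generating function at \<open>z\<close>
    gives the generating function at \<open>z / t + 1\<close>, an affine substitution in an entire
    function.\<close>
  have "(\<lambda>z::complex. \<integral>\<omega>. exp (z * of_real (V \<omega>)) \<partial>M) = (\<lambda>z. \<integral>\<omega>. z ^ I \<omega> \<partial>M) \<circ> (\<lambda>z. z / of_real t + 1)"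
    using \<open>t > 0\<close> by (simp add: fun_eq_iff identity)
  moreover have "\<dots> holomorphic_on UNIV"
    using \<open>t > 0\<close> by (intro holomorphic_on_compose_gen[OF _ hol] holomorphic_intros) auto
  ultimately have "(\<lambda>z::complex. \<integral>\<omega>. exp (z * of_real (V \<omega>)) \<partial>M) holomorphic_on UNIV"
    by simp
  then show ?thesis
    using int_I int_V hol identity by blast
qed

end
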